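(* For every real number $r\in(0,1]$, the range $\{s_{-r}(n): n\in\mathbb{N}\}$ of the function $s_{-r}$ is a dense subset of the interval $(0,1]$.
   Context: For a real number $t$, $s_t$ denotes the multiplicative arithmetic function on the positive integers $\mathbb{N}$ defined by $s_t(1)=1$ and $s_t(p^{\alpha})=\sum_{j=0}^{\alpha}(-p^t)^j$ for all primes $p$ and positive integers $\alpha$. *)

theory Defs
  imports "HOL-Analysis.Analysis" "HOL-Computational_Algebra.Primes"
begin

text \<open>
  The multiplicative function \<open>s\<^sub>t\<close>, given by multiplying its values
  \<open>s\<^sub>t(p\<^sup>a) = (\<Sum>j\<le>a. (-p\<^sup>t)\<^sup>j)\<close> over the prime power components of \<open>n\<close>.
  The three lemmas below are the properties that determine it on the positive integers; the value
  at \<open>0\<close> is junk.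
\<close>

definition s_fun :: "real \<Rightarrow> nat \<Rightarrow> real" where
  "s_fun t n = (\<Prod>p\<in>prime_factors n. \<Sum>j=0..multiplicity p n. (- (real p powr t)) ^ j)"

lemma s_fun_1: "s_fun t 1 = 1"
  by (simp add: s_fun_def)

lemma s_fun_prime_power:
  assumes "prime p" "a > 0"
  shows "s_fun t (p ^ a) = (\<Sum>j=0..a. (- (real p powr t)) ^ j)"
  using assms by (simp add: s_fun_def prime_factorization_prime_power)

lemma s_fun_mult_coprime:
  assumes "m > 0" "n > 0" "coprime m n"
  shows "s_fun t (m * n) = s_fun t m * s_fun t n"
proof -
  have disj: "prime_factors m \<inter> prime_factors n = {}"
    using assms(3) by (meson coprime_common_divisor disjoint_iff in_prime_factors_iff not_prime_unit)
  have mult: "multiplicity p (m * n) = multiplicity p m + multiplicity p n" if "prime p" for p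
    using that assms by (simp add: prime_elem_multiplicity_mult_distrib)
  have m: "multiplicity p (m * n) = multiplicity p m" if "p \<in> prime_factors m" for p
    using that disj assms mult[of p]
    by (auto simp: prime_factors_dvd intro!: not_dvd_imp_multiplicity_0)
  have n: "multiplicity p (m * n) = multiplicity p n" if "p \<in> prime_factors n" for p
    using that disj assms mult[of p]
    by (auto simp: prime_factors_dvd intro!: not_dvd_imp_multiplicity_0)
  have "prime_factors (m * n) = prime_factors m \<union> prime_factors n"
    using assms by (simp add: prime_factors_product)
  then have "s_fun t (m * n) =
      (\<Prod>p\<in>prime_factors m. \<Sum>j=0..multiplicity p (m * n). (- (real p powr t)) ^ j) *
      (\<Prod>p\<in>prime_factors n. \<Sum>j=0..multiplicity p (m * n). (- (real p powr t)) ^ j)"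
    by (simp add: s_fun_def prod.union_disjoint disj)
  then show ?thesis
    by (simp add: s_fun_def m n)
qed

end

theory Submission
  imports Defs
begin

text \<open>
  On squarefree \<open>n\<close> the value \<open>s\<^bsub>-r\<^esub>(n)\<close> is \<open>\<Prod>p dvd n. 1 - p\<^sup>-\<^sup>r\<close>. Expanding
  the Euler product shows that \<open>\<Prod>p\<le>N. 1 - 1/p\<close> is at most the reciprocal of the \<open>N\<close>-th harmonic
  number, so for \<open>r \<le> 1\<close> the products of \<open>1 - p\<^sup>-\<^sup>r\<close> over \<open>M < p \<le> K\<close> decrease from \<open>1\<close> to \<open>0\<close>
  as \<open>K\<close> grows. When all primes beyond \<open>M\<close> satisfy \<open>p\<^sup>-\<^sup>r < \<epsilon>\<close>, no step of this descent is as
  long as \<open>\<epsilon>\<close>, so it comes within \<open>\<epsilon>\<close> of every point of \<open>(0,1]\<close>.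
\<close>

text \<open>Multiplied by \<open>1 + y\<close>, the sum telescopes to
  \<open>1 - (-y) ^ Suc a\<close>, which differs from 1 by at most \<open>y\<close> and so lies in
  \<open>[1 - y, 1 + y]\<close>.\<close>

lemma alternating_geometric_sum_bounds:
  fixes y :: real
  assumes "0 < y" "y < 1"
  shows "0 < (\<Sum>j=0..a. (-y) ^ j)" "(\<Sum>j=0..a. (-y) ^ j) \<le> 1"
proof -
  have eq: "(\<Sum>j=0..a. (-y) ^ j) * (1 + y) = 1 - (-y) ^ Suc a"
    using one_diff_power_eq[of "-y" "Suc a"] by (simp add: atLeast0AtMost lessThan_Suc_atMost mult.commute)
  have "\<bar>(-y) ^ Suc a\<bar> \<le> y"
    using power_decreasing[of 1 "Suc a" y] assms by (simp add: abs_mult power_abs mult_left_le)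
  then have "0 < (\<Sum>j=0..a. (-y) ^ j) * (1 + y)" "(\<Sum>j=0..a. (-y) ^ j) * (1 + y) \<le> 1 * (1 + y)"
    unfolding eq mult_1_left using assms by linarith+
  then show "0 < (\<Sum>j=0..a. (-y) ^ j)" "(\<Sum>j=0..a. (-y) ^ j) \<le> 1"
    using assms by (auto simp: zero_less_mult_iff simp del: mult_1_left)
qed

lemma prime_powr_neg_bounds:
  assumes "prime p" "0 < r"
  shows "0 < real p powr (-r)" "real p powr (-r) < 1"
  using assms prime_gt_1_nat[of p] by (auto simp: powr_less_one)

text \<open>The factor at each prime lies in \<open>(0,1]\<close>, and this interval is closed under
  finite products.\<close>

lemma s_fun_neg_bounds:
  assumes "0 < r"
  shows "0 < s_fun (-r) n" "s_fun (-r) n \<le> 1"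
proof -
  have *: "0 < (\<Sum>j=0..a. (- (real p powr (-r))) ^ j)" "(\<Sum>j=0..a. (- (real p powr (-r))) ^ j) \<le> 1"
    if "p \<in> prime_factors n" for p a
    using alternating_geometric_sum_bounds[OF prime_powr_neg_bounds[OF in_prime_factors_imp_prime assms]] that
    by auto
  show "0 < s_fun (-r) n"
    unfolding s_fun_def by (intro prod_pos) (use * in auto)
  show "s_fun (-r) n \<le> 1"
    unfolding s_fun_def by (intro prod_le_1) (use * in \<open>auto intro: less_imp_le\<close>)
qed

lemma s_fun_prod_primes:
  assumes "finite S" "\<And>p. p \<in> S \<Longrightarrow> prime p"
  shows "s_fun t (\<Prod>S) = (\<Prod>p\<in>S. 1 - real p powr t)"
  using assms
proof (induction S rule: finite_induct)
  case empty
  then show ?case by (simp add: s_fun_def)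
next
  case (insert p S)
  have cop: "coprime p (\<Prod>S)"
    by (rule prod_coprime_right) (use insert in \<open>metis insertCI primes_coprime\<close>)
  have "\<Prod>S > 0"
    using insert.prems by (intro prod_pos) (auto simp: prime_gt_0_nat)
  moreover have "p > 0" using insert.prems by (auto simp: prime_gt_0_nat)
  ultimately have "s_fun t (p * \<Prod>S) = s_fun t p * s_fun t (\<Prod>S)"
    using cop by (intro s_fun_mult_coprime)
  moreover have "s_fun t p = 1 - real p powr t"
    using s_fun_prime_power[of p 1 t] insert.prems by simp
  moreover have "s_fun t (\<Prod>S) = (\<Prod>p\<in>S. 1 - real p powr t)"
    using insert.prems by (intro insert.IH) simp
  ultimately show ?case
    using insert.hyps by simp
qed

text \<open>A truncated Euler product: splitting off the full power of one prime \<open>p\<close> at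
  a time turns the sum into a geometric series in \<open>1/p\<close> times the sum for the remaining
  primes. The cutoff \<open>N\<close> keeps every sum finite.\<close>

lemma sum_inverse_smooth_le:
  fixes N :: nat
  assumes "finite P" "\<And>p. p \<in> P \<Longrightarrow> prime p"
  shows "(\<Sum>n | n \<in> {1..N} \<and> prime_factors n \<subseteq> P. inverse (real n)) \<le> (\<Prod>p\<in>P. inverse (1 - inverse (real p)))"
  using assms
proof (induction P rule: finite_induct)
  case empty
  \<comment> \<open>Only an inclusion, since the left side is empty for
    \<open>N = 0\<close>.\<close>
  have "{n. n \<in> {1..N} \<and> prime_factors n \<subseteq> {}} \<subseteq> {1}"
    by (auto simp: prime_factorization_empty_iff)
  then have "(\<Sum>n | n \<in> {1..N} \<and> prime_factors n \<subseteq> {}. inverse (real n)) \<le> (\<Sum>n\<in>{1}. inverse (real n))"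
    by (intro sum_mono2) auto
  then show ?case by simp
next
  case (insert p P)
  let ?A = "\<lambda>Q. {n. n \<in> {1..N} \<and> prime_factors n \<subseteq> Q}"
  let ?f = "\<lambda>(k, m). p ^ k * m"
  have p: "prime p" using insert.prems by simp
  then have x: "0 < inverse (real p)" "inverse (real p) < 1"
    using prime_gt_1_nat[of p] by (auto simp: field_simps)
  have "?A (insert p P) \<subseteq> ?f ` ({..N} \<times> ?A P)"
  proof
    fix n assume n: "n \<in> ?A (insert p P)"
    then have n0: "n > 0" by auto
    obtain m where m: "n = p ^ multiplicity p n * m" "\<not> p dvd m"
      using multiplicity_decompose'[of n p] n0 p by (metis gr_implies_not0 not_prime_unit)
    have m0: "m > 0" using m n0 by (metis mult_0_right neq0_conv)
    have "m dvd n" using m(1) by (metis dvd_triv_right)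
    then have "m \<le> n" "prime_factors m \<subseteq> prime_factors n"
      using n0 by (auto intro: dvd_imp_le simp: prime_factors_dvd)
    moreover have "p \<notin> prime_factors m" using m(2) by auto
    ultimately have "m \<in> ?A P" using n m0 by auto
    \<comment> \<open>A crude bound that makes the range of exponents finite:
      \<open>k < p ^ k \<le> n \<le> N\<close> for \<open>k = multiplicity p n\<close>.\<close>
    moreover have "multiplicity p n \<le> N"
    proof -
      have "multiplicity p n < p ^ multiplicity p n"
        using prime_gt_1_nat[OF p] by (intro power_gt_expt) simp
      also have "\<dots> \<le> n" using n0 by (intro dvd_imp_le multiplicity_dvd)
      finally show ?thesis using n by simp
    qed
    ultimately show "n \<in> ?f ` ({..N} \<times> ?A P)"
      using m(1) by (intro image_eqI[of _ _ "(multiplicity p n, m)"]) auto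
  qed
  then have "(\<Sum>n\<in>?A (insert p P). inverse (real n)) \<le> (\<Sum>n\<in>?f ` ({..N} \<times> ?A P). inverse (real n))"
    by (intro sum_mono2) auto
  \<comment> \<open>Passing from the image to the pairs can only add nonnegative terms, so
    injectivity of \<open>?f\<close> is not at issue.\<close>
  also have "\<dots> \<le> (\<Sum>z\<in>{..N} \<times> ?A P. inverse (real (?f z)))"
    using sum_image_le[of "{..N} \<times> ?A P" "\<lambda>n. inverse (real n)" ?f] by (simp add: o_def)
  also have "\<dots> = (\<Sum>k\<le>N. inverse (real p) ^ k) * (\<Sum>m\<in>?A P. inverse (real m))"
    by (simp add: sum_product sum.cartesian_product split_def power_inverse)
  also have "\<dots> \<le> inverse (1 - inverse (real p)) * (\<Prod>p\<in>P. inverse (1 - inverse (real p)))"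
  proof (rule mult_mono)
    have "(\<Sum>k\<le>N. inverse (real p) ^ k) \<le> (\<Sum>k. inverse (real p) ^ k)"
      using x by (intro sum_le_suminf summable_geometric) auto
    then show "(\<Sum>k\<le>N. inverse (real p) ^ k) \<le> inverse (1 - inverse (real p))"
      using x by (simp add: suminf_geometric inverse_eq_divide)
  qed (use insert x in \<open>auto intro: sum_nonneg\<close>)
  finally show ?case
    using insert.hyps by simp
qed

text \<open>Every \<open>n \<le> N\<close> has only prime factors up to \<open>N\<close>, so the
  smooth sum over these primes is all of \<open>harm N\<close>; inverting gives the bound.\<close>

lemma prod_one_minus_inverse_primes_le:
  assumes "N > 0"
  shows "(\<Prod>p | prime p \<and> p \<le> N. 1 - inverse (real p)) \<le> inverse (harm N)"
proof -
  let ?P = "{p. prime p \<and> p \<le> N}"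
  have "{n. n \<in> {1..N} \<and> prime_factors n \<subseteq> ?P} = {1..N}"
    by (auto simp: prime_factors_dvd intro: order_trans[OF dvd_imp_le])
  moreover have "finite ?P" "\<And>p. p \<in> ?P \<Longrightarrow> prime p"
    by auto
  ultimately have "harm N \<le> (\<Prod>p\<in>?P. inverse (1 - inverse (real p)))"
    using sum_inverse_smooth_le[of ?P N] unfolding harm_def by metis
  then have "inverse (\<Prod>p\<in>?P. inverse (1 - inverse (real p))) \<le> inverse (harm N)"
    using assms by (intro le_imp_inverse_le) auto
  then show ?thesis
    by (simp add: prod_inversef[symmetric] o_def)
qed

text \<open>The primes up to \<open>M\<close> contribute a fixed constant \<open>c > 0\<close>, so
  it suffices to push the product over all primes up to \<open>K\<close> below \<open>c * x\<close>.
  Since \<open>r \<le> 1\<close>, each factor is at most \<open>1 - 1/p\<close>, and the harmonic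
  numbers diverge.\<close>

lemma prod_one_minus_prime_powr_less:
  fixes r x :: real
  assumes "0 < r" "r \<le> 1" "0 < x"
  obtains K where "M \<le> K" "(\<Prod>p | prime p \<and> M < p \<and> p \<le> K. 1 - real p powr (-r)) < x"
proof -
  define c where "c = (\<Prod>p | prime p \<and> p \<le> M. 1 - real p powr (-r))"
  have c: "c > 0"
    unfolding c_def using prime_powr_neg_bounds[OF _ assms(1)] by (intro prod_pos) auto
  have "eventually (\<lambda>K. harm K > inverse (c * x)) sequentially"
    using harm_at_top by (simp add: filterlim_at_top_dense)
  \<comment> \<open>\<open>Suc M\<close> gives both \<open>M \<le> K\<close>, for splitting the
    product at \<open>M\<close>, and \<open>K > 0\<close>, for the harmonic bound.\<close>
  then have "eventually (\<lambda>K. harm K > inverse (c * x) \<and> K \<ge> Suc M) sequentially"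
    by (intro eventually_conj eventually_ge_at_top)
  then obtain K where K: "harm K > inverse (c * x)" "K \<ge> Suc M"
    using eventually_happens'[OF sequentially_bot] by blast
  have "c * (\<Prod>p | prime p \<and> M < p \<and> p \<le> K. 1 - real p powr (-r))
      = (\<Prod>p | prime p \<and> p \<le> K. 1 - real p powr (-r))"
    unfolding c_def using K(2)
    by (subst prod.union_disjoint[symmetric]) (auto intro!: prod.cong)
  also have "\<dots> \<le> (\<Prod>p | prime p \<and> p \<le> K. 1 - inverse (real p))"
  proof (rule prod_mono)
    fix p assume "p \<in> {p. prime p \<and> p \<le> K}"
    then have p: "prime p" by simp
    then have "real p powr (-1) \<le> real p powr (-r)"
      using assms prime_gt_1_nat[of p] by (intro powr_mono) auto
    then show "0 \<le> 1 - real p powr (-r) \<and> 1 - real p powr (-r) \<le> 1 - inverse (real p)"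
      using prime_powr_neg_bounds[OF p assms(1)] by (simp add: powr_minus)
  qed
  also have "\<dots> \<le> inverse (harm K)"
    using K by (intro prod_one_minus_inverse_primes_le) auto
  also have "\<dots> < c * x"
    using K(1) c assms(3) by (metis inverse_inverse_eq less_imp_inverse_less mult_pos_pos positive_imp_inverse_positive)
  finally show ?thesis
    using c K(2) that[of K] by simp
qed

lemma s_fun_neg_approx:
  fixes r x \<epsilon> :: real
  assumes r: "0 < r" "r \<le> 1" and x: "0 < x" "x \<le> 1" and "0 < \<epsilon>"
  obtains n where "n > 0" "\<bar>s_fun (-r) n - x\<bar> < \<epsilon>"
proof -
  have "((\<lambda>n. real n powr (-r)) \<longlongrightarrow> 0) sequentially"
    using r by (intro tendsto_neg_powr filterlim_real_sequentially) auto
  then have "eventually (\<lambda>n. real n powr (-r) < \<epsilon>) sequentially"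
    using \<open>0 < \<epsilon>\<close> by (rule order_tendstoD)
  then obtain M where M: "\<And>n. n \<ge> M \<Longrightarrow> real n powr (-r) < \<epsilon>"
    by (auto simp: eventually_sequentially)
  define S where "S K = {p. prime p \<and> M < p \<and> p \<le> K}" for K
  define F where "F K = (\<Prod>p\<in>S K. 1 - real p powr (-r))" for K
  have fin: "finite (S K)" for K
    unfolding S_def by simp
  obtain K1 where "F K1 < x"
    using prod_one_minus_prime_powr_less[OF r x(1), of M] unfolding F_def S_def by blast
  \<comment> \<open>The first index at which the decreasing products pass below \<open>x\<close>;
    the last one before it is still at least \<open>x\<close>.\<close>
  define K where "K = (LEAST K. F K < x)"
  have K: "F K < x"
    unfolding K_def by (rule LeastI) fact
  \<comment> \<open>The empty product is not below \<open>x \<le> 1\<close>, so \<open>K\<close> has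
    a predecessor.\<close>
  have "F 0 = 1"
    by (simp add: F_def S_def)
  then obtain k where k: "K = Suc k"
    using K x by (cases K) auto
  have Fk: "x \<le> F k"
    using not_less_Least[of k "\<lambda>K. F K < x"] k K_def by auto
  \<comment> \<open>Otherwise no factor is added at \<open>K\<close>, and \<open>F\<close> could not
    drop there.\<close>
  have "prime K \<and> M < K"
  proof (rule ccontr)
    assume "\<not> (prime K \<and> M < K)"
    then have "S K = S k"
      by (auto simp: S_def k le_Suc_eq)
    then show False
      using K Fk by (simp add: F_def)
  qed
  then have "S K = insert K (S k)"
    by (auto simp: S_def k)
  then have FK: "F K = (1 - real K powr (-r)) * F k"
    using fin by (simp add: F_def S_def k)
  have "F k \<le> 1"
    unfolding F_def using prime_powr_neg_bounds[OF _ r(1)]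
    by (intro prod_le_1) (auto simp: S_def less_imp_le)
  moreover have "real K powr (-r) < \<epsilon>"
    using M \<open>prime K \<and> M < K\<close> by simp
  \<comment> \<open>The left side is the drop \<open>F k - F K\<close>; as
    \<open>F K < x \<le> F k\<close>, it bounds the distance from \<open>F K\<close> to
    \<open>x\<close>.\<close>
  ultimately have "real K powr (-r) * F k < \<epsilon>"
    using Fk x by (smt (verit) mult_left_le powr_ge_zero)
  then have "\<bar>F K - x\<bar> < \<epsilon>"
    using K Fk FK by (simp add: algebra_simps)
  moreover have "s_fun (-r) (\<Prod>(S K)) = F K"
    unfolding F_def by (intro s_fun_prod_primes fin) (simp add: S_def)
  moreover have "\<Prod>(S K) > 0"
    by (intro prod_pos) (auto simp: S_def prime_gt_0_nat)
  ultimately show ?thesis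
    using that[of "\<Prod>(S K)"] by simp
qed

theorem theorem2p1:
  fixes r :: real
  assumes "r \<in> {0<..1}"
  shows "s_fun (- r) ` {n. n > 0} \<subseteq> {0<..1} \<and> {0<..1} \<subseteq> closure (s_fun (- r) ` {n. n > 0})"
proof (intro conjI subsetI)
  fix y assume "y \<in> s_fun (- r) ` {n. n > 0}"
  then show "y \<in> {0<..1}"
    using s_fun_neg_bounds assms by auto
next
  fix x :: real assume "x \<in> {0<..1}"
  then show "x \<in> closure (s_fun (- r) ` {n. n > 0})"
    unfolding closure_approachable using assms s_fun_neg_approx[of r x]
    by (auto simp: dist_real_def)
qed

end
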